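(* Let $p_L(z,w)=6-\left(w+\frac1w+z+\frac1z+\frac wz+\frac zw\right)$. Then $$2\pi\,\mathrm{m}(p_L)=10\,D\!\left(\frac{1+\sqrt3\,i}{2}\right)=10\,v_{\mathrm{tet}}.$$
   Context: Mahler measure: $\mathrm{m}(P)=\frac{1}{(2\pi i)^2}\int_{|z|=|w|=1}\log|P(z,w)|\frac{dz}{z}\frac{dw}{w}$. $D$ is the Bloch–Wigner dilogarithm $D(z)=\operatorname{Im}(\mathrm{Li}_2(z))+\arg(1-z)\log|z|$, with $\mathrm{Li}_2(z)=-\int_0^z\frac{\log(1-t)}{t}dt$. $v_{\mathrm{tet}}=D(e^{i\pi/3})\approx1.01494$ is the volume of the regular ideal hyperbolic tetrahedron. *)

theory Defs
  imports "HOL-Complex_Analysis.Complex_Analysis"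
begin

definition Li2 :: "complex \<Rightarrow> complex" where
  "Li2 z = - contour_integral (linepath 0 z) (\<lambda>t. Ln (1 - t) / t)"

definition BlochWigner :: "complex \<Rightarrow> real" where
  "BlochWigner z = Im (Li2 z) + Arg (1 - z) * ln (cmod z)"

definition vtet :: real where
  "vtet = BlochWigner (cis (pi / 3))"

definition mahler_integrand :: "(complex \<Rightarrow> complex \<Rightarrow> complex) \<Rightarrow> real \<times> real \<Rightarrow> real" where
  "mahler_integrand P = (\<lambda>(s, t). ln (cmod (P (cis s) (cis t))))"

definition torus_box :: "(real \<times> real) set" where
  "torus_box = {0..2*pi} \<times> {0..2*pi}"

definition mahler2 :: "(complex \<Rightarrow> complex \<Rightarrow> complex) \<Rightarrow> real" where
  "mahler2 P = (1 / (2*pi)^2) * (LINT x : torus_box | lborel. mahler_integrand P x)"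

definition pL :: "complex \<Rightarrow> complex \<Rightarrow> complex" where
  "pL z w = 6 - (w + 1/w + z + 1/z + w/z + z/w)"

end

theory Submission
  imports Defs "HOL-Real_Asymp.Real_Asymp"
begin

text \<open>
  On the torus, $p_L(e^{is}, e^{it}) = k\,|1 - q e^{it}|^2$ with $|q| < 1$ and
  $k = 2 (1 + y^2 + y \sqrt{y^2 + 3})$, $y = \sin (s/2)$, so the mean value property of
  $\log (1 - qz)$ evaluates the integral over $t$ as $2 \pi \log k$. For the remaining integral
  over $x = s/2$, the weights of the three cosine terms are deformed from $(0,0,1)$ to $(1,1,1)$
  through $(r,r,1)$:
  \[ \log k - \log (4 y^2) = \int_0^1 \frac{1}{r}
       \Bigl(1 - \frac{y}{\sqrt{y^2 + 2r + r^2}}\Bigr)\,dr . \]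
  The integrand is nonnegative, so Tonelli's theorem allows integrating over $x$ first, which leaves
  $\int_0^1 2 \varphi(r)\,dr/r$ with $\cos \varphi = 1/(1+r)$. With the Clausen function
  $V(\theta) = \mathrm{Im}\,\mathrm{Li}_2(e^{i\theta})$, whose derivative is
  $-\log (2 \sin (\theta/2))$, an antiderivative is
  $2 \varphi \log r + 4 V(\varphi) + V(\pi - 2 \varphi)$; since $\varphi(1) = \pi/3$, $\varphi(0) = 0$
  and $V(0) = V(\pi) = 0$, the integral equals $5 V(\pi/3)$.
\<close>

section \<open>The Clausen function and its continuity\<close>

text \<open>A constant dominates the integrand of \<open>clausen\<close> uniformly in the direction
  \<open>z\<close>, as dominated convergence requires. Near u = 0 this comes from |Ln (1 + v)| \<le>
  2 |v|, elsewhere from |Arg| \<le> pi.\<close>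

lemma abs_Arg_one_minus_div_le:
  assumes "0 < u" "u < 1" "cmod z \<le> 1"
  shows "\<bar>Arg (1 - of_real u * z) / u\<bar> \<le> 2 * pi"
proof (cases "u < 1/2")
  case True
  have n: "cmod (- (of_real u * z)) \<le> u"
    using assms by (simp add: norm_mult mult_left_le)
  with True have l: "cmod (Ln (1 + - (of_real u * z))) \<le> 2 * cmod (- (of_real u * z))"
    by (intro norm_Ln_le) auto
  have nz: "1 - of_real u * z \<noteq> 0"
  proof
    assume "1 - of_real u * z = 0"
    then have "of_real u * z = 1" by simp
    with n True show False by simp
  qed
  have "\<bar>Arg (1 - of_real u * z)\<bar> \<le> cmod (Ln (1 + - (of_real u * z)))"
    using abs_Im_le_cmod[of "Ln (1 + - (of_real u * z))"] nz by (simp add: Arg_eq_Im_Ln)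
  with l n have "\<bar>Arg (1 - of_real u * z)\<bar> \<le> 2 * u" by linarith
  also have "\<dots> \<le> 2 * pi * u" using assms pi_ge_two by simp
  finally show ?thesis using assms by (simp add: field_simps)
next
  case False
  have "\<bar>Arg (1 - of_real u * z)\<bar> \<le> pi"
    using Arg_bounded[of "1 - of_real u * z"] by auto
  also have "pi \<le> 2 * pi * u" using False pi_gt_zero by simp
  finally show ?thesis using assms by (simp add: field_simps)
qed

text \<open>For 0 < \<theta> < 2 pi this is Im Li2 (e^(i \<theta>)), integrated along a radius of
  the unit disc. In this form it makes sense at multiples of 2 pi as well, where the radius ends at
  the branch point 1. The open interval leaves out the division by 0 and that end point.\<close>

definition clausen :: "real \<Rightarrow> real" where
  "clausen \<theta> = - integral {0<..<1} (\<lambda>u. Arg (1 - of_real u * cis \<theta>) / u)"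

lemma one_minus_mult_cis_notin_nonpos_Reals:
  assumes "0 < u" "u < 1"
  shows "1 - of_real u * cis \<theta> \<notin> \<real>\<^sub>\<le>\<^sub>0"
proof -
  have "u * cos \<theta> \<le> u" using assms by simp
  then have "u * cos \<theta> < 1" using assms by linarith
  then have "Re (1 - of_real u * cis \<theta>) > 0" by simp
  then show ?thesis by (auto simp: complex_nonpos_Reals_iff)
qed

text \<open>Continuity on the whole line matters at multiples of 2 pi: the derivative has a
  logarithmic singularity there, but these points are limits of integration later on.\<close>

lemma continuous_on_clausen: "continuous_on A clausen"
proof -
  have "isCont clausen \<theta>" for \<theta>
    unfolding continuous_at_sequentially
  proof (intro allI impI)
    fix X :: "nat \<Rightarrow> real" assume X: "X \<longlonglongrightarrow> \<theta>"
    let ?f = "\<lambda>k u. Arg (1 - of_real u * cis (X k)) / u"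
    have int: "?f k integrable_on {0<..<1}" for k
    proof (rule measurable_bounded_by_integrable_imp_integrable)
      show "?f k \<in> borel_measurable (lebesgue_on {0<..<1})"
        by (intro continuous_imp_measurable_on_sets_lebesgue continuous_intros)
           (use one_minus_mult_cis_notin_nonpos_Reals in auto)
      show "(\<lambda>u::real. 2 * pi) integrable_on {0<..<1}"
        using integrable_const_ivl[of "2 * pi" 0 1] integrable_on_Icc_iff_Ioo by blast
    qed (use abs_Arg_one_minus_div_le in auto)
    have "(\<lambda>k. integral {0<..<1} (?f k)) \<longlonglongrightarrow>
       integral {0<..<1} (\<lambda>u. Arg (1 - of_real u * cis \<theta>) / u)"
    proof (rule dominated_convergence(2)[OF int])
      show "(\<lambda>u::real. 2 * pi) integrable_on {0<..<1}"
        using integrable_const_ivl[of "2 * pi" 0 1] integrable_on_Icc_iff_Ioo by blast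
      fix u :: real assume u: "u \<in> {0<..<1}"
      have "isCont (\<lambda>t. Arg (1 - of_real u * cis t) / u) \<theta>"
        using one_minus_mult_cis_notin_nonpos_Reals[of u \<theta>] u
        by (intro continuous_intros) (auto simp: isCont_def intro!: tendsto_intros)
      then show "(\<lambda>k. ?f k u) \<longlonglongrightarrow> Arg (1 - of_real u * cis \<theta>) / u"
        using X by (auto simp: continuous_at_sequentially o_def)
    qed (use abs_Arg_one_minus_div_le in auto)
    then show "(clausen \<circ> X) \<longlonglongrightarrow> clausen \<theta>"
      unfolding o_def clausen_def by (rule tendsto_minus)
  qed
  then show ?thesis by (simp add: continuous_at_imp_continuous_on)
qed

text \<open>Here \<open>cis \<theta>\<close> is 1 or -1, so 1 - u \<open>cis \<theta>\<close> is a
  positive real with argument 0. This supplies the boundary values at 0, pi and 2 pi.\<close>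

lemma clausen_real_point:
  assumes "sin \<theta> = 0"
  shows "clausen \<theta> = 0"
proof -
  have "Arg (1 - of_real u * cis \<theta>) / u = 0" if "u \<in> {0<..<1}" for u
  proof -
    have "cis \<theta> = of_real (cos \<theta>)" using assms by (simp add: complex_eq_iff)
    then have *: "1 - of_real u * cis \<theta> = of_real (1 - u * cos \<theta>)" by simp
    have "u * cos \<theta> \<le> u" using that by simp
    then have "u * cos \<theta> < 1" using that unfolding greaterThanLessThan_iff by linarith
    then have "0 < 1 - u * cos \<theta>" by simp
    then show ?thesis by (simp only: * Arg_of_real) simp
  qed
  then have "integral {0<..<1} (\<lambda>u. Arg (1 - of_real u * cis \<theta>) / u) = integral {0<..<1} (\<lambda>u::real. 0::real)"
    by (intro Henstock_Kurzweil_Integration.integral_cong) auto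
  then show ?thesis by (simp add: clausen_def)
qed

section \<open>The dilogarithm on the slit plane and the derivative of the Clausen function\<close>

text \<open>The singularity of Ln (1 - z) / z at 0 is removable and the slit plane is starlike, so a
  holomorphic primitive exists. The same F serves for differentiating Li2 and for comparing it with
  the radial integral. The point 0 is left out because division by zero gives the quotient the value
  0 there, whereas F has derivative 1.\<close>

lemma Li2_primitive:
  "\<exists>F. \<forall>z \<in> - complex_of_real ` {1..} - {0}.
     (F has_field_derivative - Ln (1 - z) / z) (at z) \<and> Li2 z = F z \<and>
     ((\<lambda>u. Ln (1 - of_real u * z) / u) has_integral - F z) {0..1}"
proof -
  define S where "S = - complex_of_real ` {1..}"
  \<comment> \<open>As Ln 1 = 0, the limit of the quotient at 0 is the derivative of Ln (1 - z), so
    this value makes \<open>g\<close> holomorphic.\<close>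
  define g where "g = (\<lambda>z. if z = 0 then deriv (\<lambda>z. Ln (1 - z)) 0 else Ln (1 - z) / z)"
  have op: "open S" unfolding S_def
    by (intro open_Compl closed_slot_right)
  have star: "starlike S" unfolding S_def by (rule starlike_slotted_complex_plane_right)
  have nonpos: "1 - z \<notin> \<real>\<^sub>\<le>\<^sub>0" if "z \<in> S" for z
  proof
    assume "1 - z \<in> \<real>\<^sub>\<le>\<^sub>0"
    then have "z = of_real (Re z)" "Re z \<ge> 1" by (auto simp: complex_nonpos_Reals_iff complex_eq_iff)
    then have "z \<in> complex_of_real ` {1..}" by blast
    with that show False by (simp add: S_def)
  qed
  have "(\<lambda>z. Ln (1 - z)) holomorphic_on S"
    by (intro holomorphic_intros nonpos)
  then have "g holomorphic_on S"
    by (rule pole_theorem_open_0[OF _ op, where a = 0]) (auto simp: g_def)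
  then obtain G where G: "\<And>z. z \<in> S \<Longrightarrow> (G has_field_derivative g z) (at z)"
    using holomorphic_starlike_primitive[OF _ star op finite.emptyI, of g]
      op holomorphic_on_imp_continuous_on holomorphic_on_imp_differentiable_at by (metis Diff_iff)
  define F where "F z = G 0 - G z" for z
  have ci: "(g has_contour_integral (G z - G 0)) (linepath 0 z)" if z: "z \<in> S" for z
  proof -
    have "closed_segment 0 z \<subseteq> S"
      using starlike_slotted_complex_plane_right_aux[of z 1 0] z by (simp add: S_def)
    then show ?thesis
      using contour_integral_primitive[of S G g "linepath 0 z"] G
      by (auto intro: has_field_derivative_at_within)
  qed
  \<comment> \<open>The factor z from parametrizing the segment cancels the z in the denominator u
    z, leaving 1/u. The two integrands can differ only at u = 0.\<close>
  have hi: "((\<lambda>u. Ln (1 - of_real u * z) / u) has_integral - F z) {0..1}"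
    if z: "z \<in> S" "z \<noteq> 0" for z
    unfolding F_def minus_diff_eq
    using ci[OF z(1), unfolded has_contour_integral_linepath]
    by (rule has_integral_spike_finite[of "{0}", rotated 2])
       (use z in \<open>auto simp: g_def linepath_def scaleR_conv_of_real\<close>)
  have ci': "((\<lambda>t. Ln (1 - t) / t) has_contour_integral - F z) (linepath 0 z)"
    if z: "z \<in> S" "z \<noteq> 0" for z
    unfolding has_contour_integral_linepath
    using hi[OF z]
    by (rule has_integral_spike_finite[of "{0}", rotated 2])
       (use z in \<open>auto simp: linepath_def scaleR_conv_of_real\<close>)
  show ?thesis
  proof (intro exI[of _ F] ballI conjI)
    fix z assume "z \<in> - complex_of_real ` {1..} - {0}"
    then have z: "z \<in> S" "z \<noteq> 0" by (auto simp: S_def)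
    show "(F has_field_derivative - Ln (1 - z) / z) (at z)"
      unfolding F_def using G[OF z(1)] z by (auto intro!: derivative_eq_intros simp: g_def)
    show "Li2 z = F z"
      unfolding Li2_def using ci'[OF z] by (simp add: contour_integral_unique)
    show "((\<lambda>u. Ln (1 - of_real u * z) / u) has_integral - F z) {0..1}"
      by (rule hi[OF z])
  qed
qed

lemma cis_in_slit_plane:
  assumes "0 < \<theta>" "\<theta> < 2 * pi"
  shows "cis \<theta> \<in> - complex_of_real ` {1..} - {0}"
proof -
  have "cis \<theta> \<notin> complex_of_real ` {1..}"
  proof
    assume "cis \<theta> \<in> complex_of_real ` {1..}"
    then have "cos \<theta> \<ge> 1" by (auto simp: complex_eq_iff)
    then have "cos \<theta> = 1" using cos_le_one[of \<theta>] by linarith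
    then obtain n :: int where n: "\<theta> = of_int n * 2 * pi"
      by (auto simp: cos_one_2pi_int)
    have "0 < n" using assms n by (simp add: zero_less_mult_iff)
    moreover have "n < 1" using assms n by simp
    ultimately show False by simp
  qed
  then show ?thesis by simp
qed

lemma cmod_one_minus_cis: "cmod (1 - cis \<theta>) = 2 * \<bar>sin (\<theta> / 2)\<bar>"
proof -
  have "(cmod (1 - cis \<theta>))\<^sup>2 = (1 - cos \<theta>)\<^sup>2 + (sin \<theta>)\<^sup>2"
    by (simp add: cmod_power2)
  also have "\<dots> = 2 - 2 * cos \<theta>"
    using sin_cos_squared_add[of \<theta>] by (simp add: power2_eq_square algebra_simps)
  also have "\<dots> = (2 * \<bar>sin (\<theta> / 2)\<bar>)\<^sup>2"
    using cos_double_sin[of "\<theta> / 2"] by (simp add: power_mult_distrib)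
  finally show ?thesis by (rule power2_eq_imp_eq) auto
qed

lemma clausen_eq_Li2:
  assumes "0 < \<theta>" "\<theta> < 2 * pi"
  shows "clausen \<theta> = Im (Li2 (cis \<theta>))"
proof -
  obtain F where F: "Li2 (cis \<theta>) = F (cis \<theta>)"
     "((\<lambda>u. Ln (1 - of_real u * cis \<theta>) / u) has_integral - F (cis \<theta>)) {0..1}"
    using Li2_primitive cis_in_slit_plane[OF assms] by blast
  from F(2) have "((\<lambda>u. Ln (1 - of_real u * cis \<theta>) / of_real u) has_integral - F (cis \<theta>)) {0<..<1}"
    by (simp only: has_integral_Icc_iff_Ioo)
  then have "((\<lambda>u. Im (Ln (1 - of_real u * cis \<theta>) / of_real u)) has_integral - Im (F (cis \<theta>))) {0<..<1}"
    by (drule_tac has_integral_linear[OF _ bounded_linear_Im]) (simp add: o_def)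
  then have "((\<lambda>u. Arg (1 - of_real u * cis \<theta>) / u) has_integral - Im (F (cis \<theta>))) {0<..<1}"
  proof (rule has_integral_eq[rotated])
    fix u :: real assume "u \<in> {0<..<1}"
    then have "1 - of_real u * cis \<theta> \<noteq> 0"
      using one_minus_mult_cis_notin_nonpos_Reals[of u \<theta>] by auto
    then show "Im (Ln (1 - of_real u * cis \<theta>) / of_real u) = Arg (1 - of_real u * cis \<theta>) / u"
      by (simp add: Arg_eq_Im_Ln)
  qed
  then show ?thesis
    using F(1) by (simp add: clausen_def integral_unique)
qed

text \<open>By the chain rule Li2 (e^(i \<theta>)) has derivative -i Ln (1 - e^(i \<theta>)). Its
  imaginary part is -ln |1 - e^(i \<theta>)|, and the modulus is the chord length 2 sin
  (\<theta>/2).\<close>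

lemma has_real_derivative_clausen:
  assumes "0 < \<theta>" "\<theta> < 2 * pi"
  shows "(clausen has_real_derivative - ln (2 * sin (\<theta> / 2))) (at \<theta>)"
proof -
  obtain F where F: "\<And>z. z \<in> - complex_of_real ` {1..} - {0} \<Longrightarrow> (F has_field_derivative - Ln (1 - z) / z) (at z)"
    "\<And>z. z \<in> - complex_of_real ` {1..} - {0} \<Longrightarrow> Li2 z = F z"
    using Li2_primitive by blast
  have "((F \<circ> cis) has_vector_derivative (\<i> * cis \<theta>) * (- Ln (1 - cis \<theta>) / cis \<theta>)) (at \<theta>)"
  proof (rule field_vector_diff_chain_at)
    show "(cis has_vector_derivative \<i> * cis \<theta>) (at \<theta>)"
      unfolding has_vector_derivative_def by (auto intro!: derivative_eq_intros)
    show "(F has_field_derivative - Ln (1 - cis \<theta>) / cis \<theta>) (at (cis \<theta>))"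
      using F(1) cis_in_slit_plane[OF assms] by simp
  qed
  then have "((\<lambda>t. Im ((F \<circ> cis) t)) has_vector_derivative Im ((\<i> * cis \<theta>) * (- Ln (1 - cis \<theta>) / cis \<theta>))) (at \<theta>)"
    by (rule bounded_linear.has_vector_derivative[OF bounded_linear_Im])
  moreover have "1 - cis \<theta> \<noteq> 0"
    using cis_in_slit_plane[OF assms] by force
  moreover have "sin (\<theta> / 2) > 0" using assms by (intro sin_gt_zero) auto
  ultimately have d: "((\<lambda>t. Im (F (cis t))) has_real_derivative - ln (2 * sin (\<theta> / 2))) (at \<theta>)"
    using cmod_one_minus_cis[of \<theta>] by (simp add: has_real_derivative_iff_has_vector_derivative o_def)
  have "\<forall>\<^sub>F t in nhds \<theta>. t \<in> {0<..<2*pi}"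
    using assms by (intro eventually_nhds_in_open) auto
  then have ev: "\<forall>\<^sub>F t in nhds \<theta>. clausen t = Im (F (cis t))"
    by eventually_elim (use F(2) cis_in_slit_plane clausen_eq_Li2 in auto)
  from d show ?thesis
    by (subst DERIV_cong_ev[OF refl ev refl])
qed

section \<open>The integral over t\<close>

text \<open>Since |q| < 1, the values 1 - q z stay in the right half-plane for |z| \<le> 1, so Ln (1
  - q z) is holomorphic there. Its mean over the unit circle is its value Ln 1 = 0 at the centre;
  the real part gives the claim.\<close>

lemma has_integral_ln_cmod_one_minus_mult_cis:
  assumes "cmod q < 1"
  shows "((\<lambda>t. ln (cmod (1 - q * cis t))) has_integral 0) {0..2 * pi}"
proof -
  have notin: "1 - q * z \<notin> \<real>\<^sub>\<le>\<^sub>0" if "cmod z \<le> 1" for z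
  proof -
    have "cmod (q * z) < 1"
      using assms that by (metis mult_right_le_one_le norm_ge_zero norm_mult order_le_less_trans)
    then have "Re (q * z) < 1" using complex_Re_le_cmod[of "q * z"] by linarith
    then show ?thesis by (auto simp: complex_nonpos_Reals_iff)
  qed
  have "(\<lambda>z. Ln (1 - q * z)) holomorphic_on cball 0 1"
    by (intro holomorphic_intros) (use notin in auto)
  from Cauchy_integral_circlepath_simple[OF this, of 0]
  have "((\<lambda>t. Ln (1 - q * cis t) / cis t * \<i> * cis t) has_integral 0) {0..2 * pi}"
    by (simp add: circlepath_def has_contour_integral_part_circlepath_iff)
  then have "((\<lambda>t. - \<i> * (Ln (1 - q * cis t) / cis t * \<i> * cis t)) has_integral - \<i> * 0) {0..2 * pi}"
    by (rule has_integral_mult_right)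
  then have "((\<lambda>t. Ln (1 - q * cis t)) has_integral 0) {0..2 * pi}"
    by (simp add: mult.assoc mult.left_commute)
  then have "((\<lambda>t. Re (Ln (1 - q * cis t))) has_integral 0) {0..2 * pi}"
    by (drule_tac has_integral_linear[OF _ bounded_linear_Re]) (simp add: o_def)
  moreover have "Re (Ln (1 - q * cis t)) = ln (cmod (1 - q * cis t))" for t
    using notin[of "cis t"] by (intro Re_Ln) auto
  ultimately show ?thesis by simp
qed

text \<open>With y = sin (s/2) \<ge> 0 this is the larger root k of k^2 - 4 (1 + y^2) k + 4 (1 -
  y^2) = 0. It is the exponential of the mean of log |p_L(e^(is), e^(it))| over t.\<close>

definition inner_mahler :: "real \<Rightarrow> real" where
  "inner_mahler y = 2 * (1 + y\<^sup>2 + y * sqrt (y\<^sup>2 + 3))"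

lemma inner_mahler_ge_2: "0 \<le> y \<Longrightarrow> 2 \<le> inner_mahler y"
  by (simp add: inner_mahler_def)

lemma inner_mahler_gt_2: "0 < y \<Longrightarrow> 2 < inner_mahler y"
  unfolding inner_mahler_def by (smt (verit) mult_pos_pos real_sqrt_gt_zero zero_less_power)

text \<open>After division by k this matches the constant terms in k |1 - q e^(it)|^2 = p_L: k + k
  |q|^2 = 6 - 2 cos s, where k^2 |q|^2 = 2 + 2 cos s = 4 (1 - y^2).\<close>

lemma inner_mahler_quadratic: "(inner_mahler y)\<^sup>2 + 4 * (1 - y\<^sup>2) = 4 * (1 + y\<^sup>2) * inner_mahler y"
proof -
  have "(sqrt (y\<^sup>2 + 3))\<^sup>2 = y\<^sup>2 + 3" by (simp add: add_nonneg_nonneg)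
  then show ?thesis unfolding inner_mahler_def by algebra
qed

lemma pL_cis: "pL (cis s) (cis t) = of_real (6 - 2 * cos s - 2 * cos t - 2 * cos (s - t))"
proof -
  have *: "1 / cis t = cis (- t)" "1 / cis s = cis (- s)" "cis t / cis s = cis (t - s)"
    "cis s / cis t = cis (s - t)"
    by (simp_all add: cis_divide inverse_eq_divide[symmetric])
  have "cos (t - s) = cos (s - t)" "sin (t - s) = - sin (s - t)"
    by (metis cos_minus minus_diff_eq, metis sin_minus minus_diff_eq)
  then show ?thesis unfolding pL_def * by (simp add: complex_eq_iff)
qed

text \<open>This is a Fejer-Riesz factorization in t. The choice k q = 1 + e^(-is) makes the cross
  term -2 Re (k q e^(it)) equal to -2 cos t - 2 cos (t - s), and the quadratic equation for k fixes
  the constant term. At s = 0 or 2 pi one would have k = 2 and q = 1, hence the open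
  interval.\<close>

lemma cmod_pL_cis:
  assumes "0 < s" "s < 2 * pi"
  defines "k \<equiv> inner_mahler (sin (s / 2))"
  defines "q \<equiv> (1 + cis (- s)) / of_real k"
  shows "cmod (pL (cis s) (cis t)) = k * (cmod (1 - q * cis t))\<^sup>2" "cmod q < 1"
proof -
  define y where "y = sin (s / 2)"
  have y: "0 < y" unfolding y_def using assms by (intro sin_gt_zero) auto
  have k: "k > 2" using inner_mahler_gt_2[OF y] by (simp add: k_def y_def)
  have cs: "cos s = 1 - 2 * y\<^sup>2"
    using cos_double_sin[of "s / 2"] by (simp add: y_def)
  have kq: "k\<^sup>2 + 4 * (1 - y\<^sup>2) = 4 * (1 + y\<^sup>2) * k"
    using inner_mahler_quadratic[of y] by (simp add: k_def y_def)
  \<comment> \<open>This is k q e^(it); its modulus does not depend on t.\<close>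
  define w where "w = cis t + cis (t - s)"
  have qw: "q * cis t = w / of_real k"
    by (simp add: q_def w_def ring_distribs cis_mult add.commute)
  have "(cmod w)\<^sup>2 = (cos t + cos (t - s))\<^sup>2 + (sin t + sin (t - s))\<^sup>2"
    by (simp add: w_def cmod_power2)
  also have "\<dots> = ((cos t)\<^sup>2 + (sin t)\<^sup>2) + ((cos (t - s))\<^sup>2 + (sin (t - s))\<^sup>2)
     + 2 * (cos t * cos (t - s) + sin t * sin (t - s))"
    by (simp add: power2_eq_square algebra_simps)
  also have "cos t * cos (t - s) + sin t * sin (t - s) = cos s"
    using cos_diff[of t "t - s"] by simp
  finally have w2: "(cmod w)\<^sup>2 = 4 * (1 - y\<^sup>2)" using cs by simp
  have "cmod w = cmod q * k"
    using arg_cong[OF qw, of cmod] k by (simp add: norm_mult norm_divide field_simps)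
  with w2 have q2: "(cmod q * k)\<^sup>2 = 4 * (1 - y\<^sup>2)" by simp
  \<comment> \<open>The bound |q| < 1 comes from |k q| \<le> 2 < k.\<close>
  have "(cmod q * k)\<^sup>2 < k\<^sup>2"
  proof -
    have "4 < k\<^sup>2" using power_strict_mono[of 2 k 2] k by simp
    moreover have "4 * (1 - y\<^sup>2) \<le> 4" by simp
    ultimately show ?thesis unfolding q2 by (rule le_less_trans[rotated])
  qed
  then have qk: "cmod q * k < k"
    by (rule power2_less_imp_less) (use k in linarith)
  show "cmod q < 1"
  proof (rule ccontr)
    assume "\<not> cmod q < 1"
    then have "1 * k \<le> cmod q * k" using k by (intro mult_right_mono) auto
    with qk show False by linarith
  qed
  have "(cmod (1 - q * cis t))\<^sup>2 = (1 - Re w / k)\<^sup>2 + (Im w / k)\<^sup>2"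
    unfolding qw by (simp add: cmod_power2)
  also have "\<dots> = 1 - 2 * Re w / k + ((Re w)\<^sup>2 + (Im w)\<^sup>2) / k\<^sup>2"
    by (simp add: power2_eq_square algebra_simps add_divide_distrib)
  also have "\<dots> = 1 - 2 * Re w / k + 4 * (1 - y\<^sup>2) / k\<^sup>2"
    using w2 by (simp add: cmod_power2)
  finally have cm: "(cmod (1 - q * cis t))\<^sup>2 = 1 - 2 * Re w / k + 4 * (1 - y\<^sup>2) / k\<^sup>2" .
  have "k * (cmod (1 - q * cis t))\<^sup>2 = (k\<^sup>2 + 4 * (1 - y\<^sup>2)) / k - 2 * Re w"
    unfolding cm using k by (simp add: power2_eq_square field_simps)
  also have "\<dots> = 4 * (1 + y\<^sup>2) - 2 * Re w"
    unfolding kq using k by simp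
  also have "\<dots> = 6 - 2 * cos s - 2 * cos t - 2 * cos (s - t)"
  proof -
    have "cos (t - s) = cos (s - t)" by (metis cos_minus minus_diff_eq)
    then show ?thesis using cs by (simp add: w_def)
  qed
  finally have e: "k * (cmod (1 - q * cis t))\<^sup>2 = 6 - 2 * cos s - 2 * cos t - 2 * cos (s - t)" .
  have "0 \<le> k * (cmod (1 - q * cis t))\<^sup>2" using k by simp
  then show "cmod (pL (cis s) (cis t)) = k * (cmod (1 - q * cis t))\<^sup>2"
    unfolding pL_cis norm_of_real e by simp
qed

lemma has_integral_ln_cmod_pL_cis:
  assumes "0 < s" "s < 2 * pi"
  shows "((\<lambda>t. ln (cmod (pL (cis s) (cis t)))) has_integral 2 * pi * ln (inner_mahler (sin (s / 2)))) {0..2 * pi}"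
proof -
  define k where "k = inner_mahler (sin (s / 2))"
  define q where "q = (1 + cis (- s)) / of_real k"
  note p = cmod_pL_cis[OF assms, folded k_def, folded q_def]
  have "k > 2" unfolding k_def using assms by (intro inner_mahler_gt_2 sin_gt_zero) auto
  have ln_eq: "ln (cmod (pL (cis s) (cis t))) = ln k + 2 * ln (cmod (1 - q * cis t))" for t
  proof -
    have "cmod (q * cis t) < 1" using p(2) by (simp add: norm_mult)
    then have "1 - q * cis t \<noteq> 0" by auto
    then show ?thesis unfolding p(1) using \<open>k > 2\<close> by (simp add: ln_mult ln_realpow)
  qed
  have "((\<lambda>t. ln k + 2 * ln (cmod (1 - q * cis t))) has_integral ln k * (2 * pi - 0) + 2 * 0) {0..2 * pi}"
    using has_integral_const_real[of "ln k" 0 "2 * pi"]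
    by (intro has_integral_add has_integral_mult_right has_integral_ln_cmod_one_minus_mult_cis p(2))
      (simp add: mult.commute)
  then show ?thesis unfolding ln_eq by (simp add: k_def mult_ac)
qed

section \<open>The deformation in r: radial and angular integrals\<close>

text \<open>The parameter $r$ deforms the polynomial to weights $(r, r, 1)$: the function
  $2 (r + y^2 + y \sqrt{y^2 + 2 r + r^2})$ is the
  Mahler measure in $w$ of the weighted polynomial at $z = e^{is}$, $y = \sin (s/2)$.\<close>
lemma has_integral_radial:
  assumes y: "0 < y"
  shows "((\<lambda>r. (1 - y / sqrt (y\<^sup>2 + 2 * r + r\<^sup>2)) / r) has_integral ln (inner_mahler y) - ln (4 * y\<^sup>2)) {0..1}"
proof -
  define F where "F r = ln (2 * (r + y\<^sup>2 + y * sqrt (y\<^sup>2 + 2 * r + r\<^sup>2)))" for r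
  have pos: "0 < 2 * (r + y\<^sup>2 + y * sqrt (y\<^sup>2 + 2 * r + r\<^sup>2))" if "0 \<le> r" for r
    using y that by (intro mult_pos_pos add_pos_nonneg add_nonneg_pos) auto
  have "((\<lambda>r. (1 - y / sqrt (y\<^sup>2 + 2 * r + r\<^sup>2)) / r) has_integral F 1 - F 0) {0..1}"
  \<comment> \<open>At r = 0 the integrand is 0 by division by zero, which is not F'(0) = 1/y^2, so
    F is differentiated in the interior only.\<close>
  proof (rule fundamental_theorem_of_calculus_interior)
    show "continuous_on {0..1} F"
      unfolding F_def by (intro continuous_intros) (use pos in fastforce)
    fix r :: real assume r: "r \<in> {0<..<1}"
    define S where "S = sqrt (y\<^sup>2 + 2 * r + r\<^sup>2)"
    have pos': "0 < y\<^sup>2 + 2 * r + r\<^sup>2" using y r by (intro add_pos_nonneg) auto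
    then have S: "S > 0" "S\<^sup>2 = y\<^sup>2 + 2 * r + r\<^sup>2" by (simp_all add: S_def)
    define N where "N = r + y\<^sup>2 + y * S"
    have N: "N > 0" using pos[of r] r by (simp add: N_def S_def)
    have "((\<lambda>r. sqrt (y\<^sup>2 + 2 * r + r\<^sup>2)) has_real_derivative (1 + r) / S) (at r)"
      using pos' by (auto intro!: derivative_eq_intros simp: S_def divide_simps)
    then have "((\<lambda>r. 2 * (r + y\<^sup>2 + y * sqrt (y\<^sup>2 + 2 * r + r\<^sup>2))) has_real_derivative
        2 * (1 + 0 + y * ((1 + r) / S))) (at r)"
      by (intro DERIV_cmult DERIV_add DERIV_ident DERIV_const)
    then have "(F has_real_derivative inverse (2 * N) * (2 * (1 + 0 + y * ((1 + r) / S)))) (at r)"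
      unfolding F_def N_def S_def using pos[of r] r by (intro DERIV_chain2[OF DERIV_ln]) auto
    also have "inverse (2 * N) * (2 * (1 + 0 + y * ((1 + r) / S))) = (S + y * (1 + r)) / (S * N)"
      using S N by (simp add: field_simps)
    also have "(S + y * (1 + r)) / (S * N) = (1 - y / S) / r"
    proof -
      \<comment> \<open>On expanding the right side, y^2 S cancels and S^2 - y^2 = r (2 + r) lets a
        factor r be taken out; this produces the 1/r of the integrand.\<close>
      have "(S + y * (1 + r)) * r = (S - y) * N"
        unfolding N_def using S(2) by algebra
      then have "(S + y * (1 + r)) * r / (S * N * r) = (S - y) * N / (S * N * r)" by simp
      then show ?thesis using S N r by (simp add: diff_divide_distrib)
    qed
    finally show "(F has_vector_derivative (1 - y / sqrt (y\<^sup>2 + 2 * r + r\<^sup>2)) / r) (at r)"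
      by (simp add: has_real_derivative_iff_has_vector_derivative S_def)
  qed auto
  moreover have "F 1 = ln (inner_mahler y)" by (simp add: F_def inner_mahler_def algebra_simps)
  moreover have "F 0 = ln (4 * y\<^sup>2)" using y by (simp add: F_def power2_eq_square)
  ultimately show ?thesis by simp
qed

text \<open>With S the square root and v = cos x / S, the derivative of v is -(sin x / S) (1 + v^2),
  so arctan v has derivative -sin x / S. The end points give pi - 2 arctan (1 / sqrt (2 r + r^2)),
  which is 2 arctan (sqrt (2 r + r^2)).\<close>

lemma has_integral_angular:
  assumes r: "0 < r"
  shows "((\<lambda>x. (1 - sin x / sqrt ((sin x)\<^sup>2 + 2 * r + r\<^sup>2)) / r) has_integral
     2 * arctan (sqrt (2 * r + r\<^sup>2)) / r) {0..pi}"
proof -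
  define F where "F x = (x + arctan (cos x / sqrt ((sin x)\<^sup>2 + 2 * r + r\<^sup>2))) / r" for x
  have pos: "0 < (sin x)\<^sup>2 + 2 * r + r\<^sup>2" for x
    using r by (intro add_pos_pos add_nonneg_pos) auto
  have "((\<lambda>x. (1 - sin x / sqrt ((sin x)\<^sup>2 + 2 * r + r\<^sup>2)) / r) has_integral F pi - F 0) {0..pi}"
  proof (rule fundamental_theorem_of_calculus)
    fix x :: real
    define S where "S = sqrt ((sin x)\<^sup>2 + 2 * r + r\<^sup>2)"
    have S: "S > 0" using pos[of x] by (simp add: S_def)
    define c where "c = 1 + (cos x / S)\<^sup>2"
    have c: "c > 0" unfolding c_def by (simp add: add_pos_nonneg)
    have c_eq: "c * S\<^sup>2 = S\<^sup>2 + (cos x)\<^sup>2" using S by (simp add: c_def field_simps)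
    have d1: "((\<lambda>x. sqrt ((sin x)\<^sup>2 + 2 * r + r\<^sup>2)) has_real_derivative sin x * cos x / S) (at x)"
      using pos[of x] by (auto intro!: derivative_eq_intros simp: S_def field_simps)
    have "((\<lambda>x. cos x / sqrt ((sin x)\<^sup>2 + 2 * r + r\<^sup>2)) has_real_derivative
       (- sin x * S - cos x * (sin x * cos x / S)) / (S * S)) (at x)"
      using DERIV_divide[OF DERIV_cos d1] S by (simp add: S_def[symmetric])
    also have "(- sin x * S - cos x * (sin x * cos x / S)) / (S * S) = - (sin x / S) * c"
      using S by (simp add: c_def power2_eq_square field_simps)
    finally have "((\<lambda>x. arctan (cos x / sqrt ((sin x)\<^sup>2 + 2 * r + r\<^sup>2))) has_real_derivative
        inverse c * (- (sin x / S) * c)) (at x)"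
      unfolding c_def S_def by (rule DERIV_chain2[OF DERIV_arctan])
    then have "((\<lambda>x. arctan (cos x / sqrt ((sin x)\<^sup>2 + 2 * r + r\<^sup>2))) has_real_derivative
        - (sin x / S)) (at x)"
      using c by (simp add: field_simps)
    then have "(F has_real_derivative (1 - sin x / S) / r) (at x)"
      unfolding F_def by (drule_tac DERIV_cdivide[OF DERIV_add[OF DERIV_ident], of _ _ _ _ r]) simp
    then show "(F has_vector_derivative (1 - sin x / sqrt ((sin x)\<^sup>2 + 2 * r + r\<^sup>2)) / r) (at x within {0..pi})"
      by (simp add: has_real_derivative_iff_has_vector_derivative S_def has_vector_derivative_at_within)
  qed auto
  moreover have "F pi - F 0 = 2 * arctan (sqrt (2 * r + r\<^sup>2)) / r"
  proof -
    have "0 < sqrt (2 * r + r\<^sup>2)" using r by (simp add: add_pos_pos)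
    then have "arctan (1 / sqrt (2 * r + r\<^sup>2)) = pi / 2 - arctan (sqrt (2 * r + r\<^sup>2))"
      using arctan_inverse[of "sqrt (2 * r + r\<^sup>2)"] by (simp add: inverse_eq_divide)
    then show ?thesis using r
      by (simp add: F_def arctan_minus minus_divide_left[symmetric] diff_divide_distrib[symmetric])
  qed
  ultimately show ?thesis by simp
qed

section \<open>Integrals evaluated by the Clausen function\<close>

text \<open>Integration by parts turns 2 \<phi> dr / r into 2 \<phi> ln r minus the integral of 2 ln
  r d\<phi>. From cos \<phi> = 1/(1 + r) follows r = (2 sin (\<phi>/2))^2 / (2 cos \<phi>), so ln r
  splits into terms integrated by \<open>clausen\<close> at \<phi> and at pi - 2 \<phi>.\<close>

lemma has_integral_arctan_div:
  "((\<lambda>r. 2 * arctan (sqrt (2 * r + r\<^sup>2)) / r) has_integral 5 * clausen (pi / 3)) {0..1}"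
proof -
  define \<phi> where "\<phi> r = arctan (sqrt (2 * r + r\<^sup>2))" for r :: real
  define F where "F r = 2 * (\<phi> r * ln r) + 4 * clausen (\<phi> r) + clausen (pi - 2 * \<phi> r)" for r
  have cont_phi: "continuous_on A \<phi>" for A unfolding \<phi>_def by (intro continuous_intros)
  have cont: "continuous_on {0..1} (\<lambda>r. \<phi> r * ln r)"
    unfolding continuous_on_def
  proof
    fix r :: real assume r: "r \<in> {0..1}"
    show "((\<lambda>r. \<phi> r * ln r) \<longlongrightarrow> \<phi> r * ln r) (at r within {0..1})"
    proof (cases "r = 0")
      case True
      \<comment> \<open>Near 0 the angle \<open>\<phi> r\<close> behaves like sqrt (2 r), which
        beats the logarithm; the value at 0 is 0 because \<open>\<phi> 0 = 0\<close>.\<close>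
      have "((\<lambda>r. \<phi> r * ln r) \<longlongrightarrow> 0) (at_right 0)"
        unfolding \<phi>_def by real_asymp
      then have "((\<lambda>r. \<phi> r * ln r) \<longlongrightarrow> 0) (at 0 within {0..1})"
        using at_within_Icc_at_right[of 0 "1::real"] by simp
      then show ?thesis using True by simp
    next
      case False
      have "isCont \<phi> r" using cont_phi[of UNIV] by (simp add: continuous_on_eq_continuous_at)
      then have "isCont (\<lambda>r. \<phi> r * ln r) r" using False by (intro continuous_intros) auto
      then show ?thesis by (meson continuous_at_imp_continuous_at_within continuous_within)
    qed
  qed
  have "((\<lambda>r. 2 * \<phi> r / r) has_integral F 1 - F 0) {0..1}"
  proof (rule fundamental_theorem_of_calculus_interior)
    show "continuous_on {0..1} F"
      unfolding F_def
      by (intro continuous_intros cont cont_phi continuous_on_compose2[OF continuous_on_clausen[of UNIV]]) auto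
    fix r :: real assume r: "r \<in> {0<..<1}"
    define S where "S = sqrt (2 * r + r\<^sup>2)"
    have pos: "0 < 2 * r + r\<^sup>2" using r by (intro add_pos_pos) auto
    then have S: "S > 0" "S\<^sup>2 = 2 * r + r\<^sup>2" by (simp_all add: S_def)
    have ph: "0 < \<phi> r" "\<phi> r < pi / 2"
      using S arctan_ubound by (simp_all add: \<phi>_def S_def)
    have S1: "1 + S\<^sup>2 = (1 + r)\<^sup>2" unfolding S(2) by (simp add: power2_eq_square algebra_simps)
    have cosp: "cos (\<phi> r) = 1 / (1 + r)"
      using cos_arctan[of S] r S1 by (simp add: \<phi>_def S_def[symmetric])
    define d where "d = (1 + r) / (S * (1 + S\<^sup>2))"
    have dphi: "(\<phi> has_real_derivative d) (at r)"
    proof -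
      have "((\<lambda>r. sqrt (2 * r + r\<^sup>2)) has_real_derivative (1 + r) / S) (at r)"
        using pos by (auto intro!: derivative_eq_intros simp: S_def divide_simps)
      from DERIV_chain2[OF DERIV_arctan this] show ?thesis
        unfolding \<phi>_def S_def[symmetric] by (simp add: d_def divide_simps mult.commute)
    qed
    have "2 * (2 * (sin (\<phi> r / 2))\<^sup>2) = 2 * (r / (1 + r))"
      using cos_double_sin[of "\<phi> r / 2"] cosp r by (simp add: field_simps)
    then have e: "(2 * sin (\<phi> r / 2))\<^sup>2 = r * (2 * cos (\<phi> r))"
      by (simp add: cosp power_mult_distrib)
    have sp: "sin (\<phi> r / 2) > 0" using ph by (intro sin_gt_zero) auto
    have cp: "cos (\<phi> r) > 0" using cosp r by simp
    have lne: "2 * ln (2 * sin (\<phi> r / 2)) = ln r + ln (2 * cos (\<phi> r))"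
      using arg_cong[OF e, of ln] sp cp r ln_realpow[of 2 2] by (simp add: ln_realpow ln_mult)
    have d1: "((\<lambda>r. clausen (\<phi> r)) has_real_derivative - ln (2 * sin (\<phi> r / 2)) * d) (at r)"
      by (rule DERIV_chain2[OF has_real_derivative_clausen dphi]) (use ph in auto)
    have d2: "((\<lambda>r. clausen (pi - 2 * \<phi> r)) has_real_derivative
       - ln (2 * sin ((pi - 2 * \<phi> r) / 2)) * (- 2 * d)) (at r)"
      by (rule DERIV_chain2[OF has_real_derivative_clausen])
         (use ph in \<open>auto intro!: derivative_eq_intros dphi\<close>)
    have "sin ((pi - 2 * \<phi> r) / 2) = cos (\<phi> r)"
      by (simp add: cos_sin_eq diff_divide_distrib)
    note d2' = d2[unfolded this]
    have "(F has_real_derivative 2 * (d * ln r + \<phi> r * (1 / r)) + 4 * (- ln (2 * sin (\<phi> r / 2)) * d)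
       + (- ln (2 * cos (\<phi> r)) * (- 2 * d))) (at r)"
      unfolding F_def using r
      by (auto intro!: derivative_eq_intros d1 d2' dphi)
    also have "2 * (d * ln r + \<phi> r * (1 / r)) + 4 * (- ln (2 * sin (\<phi> r / 2)) * d)
       + (- ln (2 * cos (\<phi> r)) * (- 2 * d)) = 2 * \<phi> r / r + 2 * d * (ln r + ln (2 * cos (\<phi> r)) - 2 * ln (2 * sin (\<phi> r / 2)))"
      by (simp add: algebra_simps)
    also have "\<dots> = 2 * \<phi> r / r" using lne by simp
    finally show "(F has_vector_derivative 2 * \<phi> r / r) (at r)"
      by (simp add: has_real_derivative_iff_has_vector_derivative)
  qed auto
  \<comment> \<open>At r = 1 both arguments \<phi> and pi - 2 \<phi> equal pi/3 and ln r = 0, so the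
    coefficients add up to 4 + 1 = 5.\<close>
  moreover have "F 1 = 5 * clausen (pi / 3)"
  proof -
    have "\<phi> 1 = pi / 3"
      using arctan_tan[of "pi / 3"] by (simp add: \<phi>_def tan_60)
    moreover have "pi - 2 * (pi / 3) = pi / 3" by simp
    ultimately show ?thesis by (simp only: F_def) simp
  qed
  moreover have "F 0 = 0"
    by (simp add: F_def \<phi>_def clausen_real_point)
  ultimately show ?thesis by (simp add: \<phi>_def)
qed

text \<open>The function -\<open>clausen\<close> (2 x) is an antiderivative and vanishes at both
  ends. The logarithmic singularities at 0 and pi are absorbed by the continuity of
  \<open>clausen\<close>.\<close>

lemma has_integral_ln_4_sin_squared: "((\<lambda>x. ln (4 * (sin x)\<^sup>2)) has_integral 0) {0..pi}"
proof -
  have "((\<lambda>x. ln (4 * (sin x)\<^sup>2)) has_integral - clausen (2 * pi) - - clausen (2 * 0)) {0..pi}"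
  proof (rule fundamental_theorem_of_calculus_interior)
    show "continuous_on {0..pi} (\<lambda>x. - clausen (2 * x))"
      by (intro continuous_intros continuous_on_compose2[OF continuous_on_clausen[of UNIV]]) auto
    fix x assume x: "x \<in> {0<..<pi}"
    then have "sin x > 0" by (intro sin_gt_zero) auto
    then have "ln (4 * (sin x)\<^sup>2) = 2 * ln (2 * sin x)"
      using ln_realpow[of 2 2] by (simp add: ln_mult ln_realpow)
    moreover have "((\<lambda>x. clausen (2 * x)) has_real_derivative - ln (2 * sin (2 * x / 2)) * 2) (at x)"
      by (rule DERIV_chain2[OF has_real_derivative_clausen])
         (use x in \<open>auto intro!: derivative_eq_intros\<close>)
    ultimately have "((\<lambda>x. - clausen (2 * x)) has_real_derivative ln (4 * (sin x)\<^sup>2)) (at x)"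
      by (auto intro!: derivative_eq_intros)
    then show "((\<lambda>x. - clausen (2 * x)) has_vector_derivative ln (4 * (sin x)\<^sup>2)) (at x)"
      by (simp add: has_real_derivative_iff_has_vector_derivative)
  qed auto
  then show ?thesis by (simp add: clausen_real_point)
qed

section \<open>The outer integral of log k\<close>

lemma continuous_on_inner_mahler_sin: "continuous_on A (\<lambda>x. ln (inner_mahler (sin x)))" if "A \<subseteq> {0..pi}"
proof -
  have "inner_mahler (sin x) \<noteq> 0" if "x \<in> A" for x
    using inner_mahler_ge_2[of "sin x"] sin_ge_zero[of x] that \<open>A \<subseteq> {0..pi}\<close> by force
  moreover have "continuous_on A (\<lambda>x. inner_mahler (sin x))"
    unfolding inner_mahler_def by (intro continuous_intros)
  ultimately show ?thesis by (intro continuous_on_ln) auto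
qed

lemma has_integral_ln_inner_mahler_sin: "((\<lambda>x. ln (inner_mahler (sin x))) has_integral 5 * clausen (pi / 3)) {0..pi}"
proof -
  define G where "G x r = (1 - sin x / sqrt ((sin x)\<^sup>2 + 2 * r + r\<^sup>2)) / r" for x r :: real
  define h where "h x = ln (inner_mahler (sin x)) - ln (4 * (sin x)\<^sup>2)" for x
  define p where "p r = 2 * arctan (sqrt (2 * r + r\<^sup>2)) / r" for r :: real
  define J where "J = integral {0..pi} (\<lambda>x. ln (inner_mahler (sin x)))"
  have J: "((\<lambda>x. ln (inner_mahler (sin x))) has_integral J) {0..pi}"
    unfolding J_def
    by (intro integrable_integral integrable_continuous_interval continuous_on_inner_mahler_sin) auto
  \<comment> \<open>Subtracting ln (4 sin^2 x) costs nothing, as its integral is 0, and makes the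
    integrand an integral over r.\<close>
  have hJ: "(h has_integral J) {0<..<pi}"
    using has_integral_diff[OF J has_integral_ln_4_sin_squared]
    by (simp add: h_def[abs_def] has_integral_Icc_iff_Ioo)
  have pV: "(p has_integral 5 * clausen (pi / 3)) {0<..<1}"
    using has_integral_arctan_div by (simp add: p_def[abs_def] has_integral_Icc_iff_Ioo)
  have Gr: "(G x has_integral h x) {0<..<1}" if "x \<in> {0<..<pi}" for x
    using has_integral_radial[of "sin x"] sin_gt_zero[of x] that
    by (simp add: G_def[abs_def] h_def has_integral_Icc_iff_Ioo)
  have Gx: "((\<lambda>x. G x r) has_integral p r) {0<..<pi}" if "r \<in> {0<..<1}" for r
    using has_integral_angular[of r] that
    by (simp add: G_def p_def has_integral_Icc_iff_Ioo)
  have G0: "0 \<le> G x r" if "x \<in> {0<..<pi}" "r \<in> {0<..<1}" for x r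
  proof -
    have s: "sin x > 0" using that by (intro sin_gt_zero) auto
    have "sin x \<le> sqrt ((sin x)\<^sup>2 + 2 * r + r\<^sup>2)"
      using that by (intro real_le_rsqrt) auto
    then have "sin x / sqrt ((sin x)\<^sup>2 + 2 * r + r\<^sup>2) \<le> 1" using s by (intro divide_le_eq_1_pos[THEN iffD2]) linarith+
    then show ?thesis using that by (simp add: G_def)
  qed
  have h0: "0 \<le> h x" if "x \<in> {0<..<pi}" for x
    by (rule has_integral_nonneg[OF Gr[OF that]]) (use G0 that in blast)
  have p0: "0 \<le> p r" if "r \<in> {0<..<1}" for r
    using that by (simp add: p_def)
  \<comment> \<open>With values in \<open>ennreal\<close>, Tonelli's theorem needs only
    measurability of the nonnegative kernel \<open>G\<close>, not its integrability on the
    rectangle.\<close>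
  have "ennreal J = (\<integral>\<^sup>+x. ennreal (h x) * indicator {0<..<pi} x \<partial>lborel)"
    using nn_integral_has_integral_lebesgue'[OF h0 hJ] by simp
  also have "\<dots> = (\<integral>\<^sup>+x. (\<integral>\<^sup>+r. ennreal (G x r) * indicator {0<..<1} r * indicator {0<..<pi} x \<partial>lborel) \<partial>lborel)"
  proof (intro nn_integral_cong)
    fix x :: real
    show "ennreal (h x) * indicator {0<..<pi} x =
      (\<integral>\<^sup>+r. ennreal (G x r) * indicator {0<..<1} r * indicator {0<..<pi} x \<partial>lborel)"
    proof (cases "x \<in> {0<..<pi}")
      case True
      from nn_integral_has_integral_lebesgue'[OF G0[OF True] Gr[OF True]] True show ?thesis by simp
    qed simp
  qed
  also have "\<dots> = (\<integral>\<^sup>+r. (\<integral>\<^sup>+x. ennreal (G x r) * indicator {0<..<1} r * indicator {0<..<pi} x \<partial>lborel) \<partial>lborel)"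
    unfolding G_def by (rule lborel_pair.Fubini') measurable
  also have "\<dots> = (\<integral>\<^sup>+r. ennreal (p r) * indicator {0<..<1} r \<partial>lborel)"
  proof (intro nn_integral_cong)
    fix r :: real
    show "(\<integral>\<^sup>+x. ennreal (G x r) * indicator {0<..<1} r * indicator {0<..<pi} x \<partial>lborel) =
      ennreal (p r) * indicator {0<..<1} r"
    proof (cases "r \<in> {0<..<1}")
      case True
      from nn_integral_has_integral_lebesgue'[OF G0[OF _ True] Gx[OF True]] True show ?thesis
        by (simp add: mult.commute mult.left_commute)
    qed simp
  qed
  also have "\<dots> = ennreal (5 * clausen (pi / 3))"
    using nn_integral_has_integral_lebesgue'[OF p0 pV] by simp
  finally have "ennreal J = ennreal (5 * clausen (pi / 3))" .
  \<comment> \<open>The map \<open>ennreal\<close> sends all negative reals to 0, so both signs are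
    checked before it is cancelled.\<close>
  moreover have "0 \<le> J" by (rule has_integral_nonneg[OF hJ h0])
  moreover have "0 \<le> 5 * clausen (pi / 3)" by (rule has_integral_nonneg[OF pV p0])
  ultimately have "J = 5 * clausen (pi / 3)" by (simp only: ennreal_inj)
  with J show ?thesis by simp
qed

lemma has_integral_ln_inner_mahler_sin_half:
  "((\<lambda>s. ln (inner_mahler (sin (s / 2)))) has_integral 10 * clausen (pi / 3)) {0..2 * pi}"
proof -
  have "((\<lambda>x. ln (inner_mahler (sin ((1 / 2) * x)))) has_integral (1 / \<bar>1 / 2\<bar>) *\<^sub>R (5 * clausen (pi / 3)))
      ((\<lambda>x. x / (1 / 2)) ` {0..pi})"
    by (rule has_integral_stretch_real) (use has_integral_ln_inner_mahler_sin in auto)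
  moreover have "(\<lambda>x. x / (1 / 2)) ` {0..pi} = {0..2 * pi}"
    using image_mult_atLeastAtMost[of 2 0 pi] by (simp add: mult.commute)
  ultimately show ?thesis by simp
qed

section \<open>Integration over the torus\<close>

text \<open>The integrand is unbounded below near the corners of the box, where p_L vanishes, but
  bounded above by ln 12. Fubini's theorem is therefore applied to the nonnegative function ln 12 -
  ln |p_L|, whose integrability follows from its iterated integral.\<close>

lemma integral_torus_pL:
  "set_integrable lborel torus_box (mahler_integrand pL)"
  "(LINT x : torus_box | lborel. mahler_integrand pL x) = 2 * pi * (10 * clausen (pi / 3))"
proof -
  define I where "I = {0..2 * pi}"
  define f where "f s t = ln (cmod (pL (cis s) (cis t)))" for s t
  define g where "g s t = indicator I s * indicator I t * (ln 12 - f s t)" for s t :: real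
  define m where "m s = 2 * pi * ln 12 - 2 * pi * ln (inner_mahler (sin (s / 2)))" for s
  have meas [measurable]: "(\<lambda>(s, t). f s t) \<in> borel_measurable (borel \<Otimes>\<^sub>M borel)"
    unfolding f_def pL_cis norm_of_real by measurable
  \<comment> \<open>The constant is 12 = 6 + 3 * 2, with all three cosines at -1 as a crude bound.
    At a zero of p_L the convention ln 0 = 0 keeps the inequality true.\<close>
  have f_le: "f s t \<le> ln 12" for s t
  proof (cases "pL (cis s) (cis t) = 0")
    case False
    have "cmod (pL (cis s) (cis t)) \<le> 12"
      unfolding pL_cis norm_of_real
      using cos_ge_minus_one[of s] cos_ge_minus_one[of t] cos_ge_minus_one[of "s - t"]
        cos_le_one[of s] cos_le_one[of t] cos_le_one[of "s - t"] by linarith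
    then show ?thesis unfolding f_def using False by (subst ln_le_cancel_iff) auto
  qed (simp add: f_def)
  have g0: "0 \<le> g s t" for s t
    using f_le[of s t] by (simp add: g_def)
  \<comment> \<open>The factorization in t is available for 0 < s < 2 pi; the two excluded values of
    s form a null set.\<close>
  have inner: "has_bochner_integral lborel (g s) (indicator I s * m s)" if s: "s \<noteq> 0" "s \<noteq> 2 * pi" for s
  proof (cases "s \<in> I")
    case True
    then have s': "0 < s" "s < 2 * pi" using s by (auto simp: I_def)
    have "((\<lambda>t. ln 12 - f s t) has_integral (2 * pi - 0) *\<^sub>R ln 12 - 2 * pi * ln (inner_mahler (sin (s / 2)))) {0..2 * pi}"
      unfolding f_def
      by (intro has_integral_diff has_integral_ln_cmod_pL_cis s') (use has_integral_const_real[of "ln (12::real)" 0 "2 * pi"] in simp)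
    then have hi: "((\<lambda>t. ln 12 - f s t) has_integral m s) I"
      by (simp add: m_def I_def)
    have "(\<integral>\<^sup>+t. ennreal (ln 12 - f s t) * indicator I t \<partial>lborel) = ennreal (m s)"
      by (rule nn_integral_has_integral_lebesgue'[OF _ hi]) (simp add: f_le)
    moreover have "ennreal (ln 12 - f s t) * indicator I t = ennreal (g s t)" for t
      using True by (auto simp: g_def indicator_def)
    moreover have "0 \<le> m s"
      by (rule has_integral_nonneg[OF hi]) (simp add: f_le)
    moreover have "g s \<in> borel_measurable lborel"
      unfolding g_def[abs_def] I_def f_def pL_cis norm_of_real by measurable
    ultimately show ?thesis using True
      by (intro has_bochner_integral_nn_integral AE_I2 g0) simp_all
  next
    case False
    then show ?thesis by (simp add: g_def[abs_def] has_bochner_integral_zero)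
  qed
  have "AE s in lborel. s \<noteq> 0 \<and> s \<noteq> 2 * pi"
    using AE_lborel_singleton[of 0] AE_lborel_singleton[of "2 * pi"] by auto
  then have AE_inner: "AE s in lborel. has_bochner_integral lborel (g s) (indicator I s * m s)"
    by eventually_elim (use inner in auto)
  have "continuous_on I m"
  proof -
    have "continuous_on I (\<lambda>s. ln (inner_mahler (sin (s / 2))))"
      by (rule continuous_on_compose2[OF continuous_on_inner_mahler_sin[OF order_refl]])
        (auto simp: I_def intro!: continuous_intros)
    then show ?thesis unfolding m_def
      by (intro continuous_on_diff continuous_on_mult continuous_on_const)
  qed
  then have m_int: "set_integrable lborel I m"
    unfolding I_def by (rule borel_integrable_atLeastAtMost')
  have "(m has_integral (2 * pi - 0) *\<^sub>R (2 * pi * ln 12) - 2 * pi * (10 * clausen (pi / 3))) I"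
    unfolding m_def I_def
    by (intro has_integral_diff has_integral_mult_right has_integral_ln_inner_mahler_sin_half)
       (use has_integral_const_real[of "2 * pi * ln (12::real)" 0 "2 * pi"] in simp)
  then have m_val: "(LINT s:I|lborel. m s) = 4 * pi\<^sup>2 * ln 12 - 2 * pi * (10 * clausen (pi / 3))"
    using set_borel_integral_eq_integral(2)[OF m_int]
    by (simp add: integral_unique power2_eq_square)
  have g_meas [measurable]: "(\<lambda>(s, t). g s t) \<in> borel_measurable (lborel \<Otimes>\<^sub>M lborel)"
    unfolding g_def I_def by measurable
  have g_int: "integrable (lborel \<Otimes>\<^sub>M lborel) (\<lambda>(s, t). g s t)"
  proof (rule lborel_pair.Fubini_integrable)
    have "integrable lborel (\<lambda>s. indicator I s * m s)"
      using m_int by (simp add: set_integrable_def)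
    then show "integrable lborel (\<lambda>s. LINT t|lborel. norm (case (s, t) of (s, t) \<Rightarrow> g s t))"
    proof (rule integrable_cong_AE_imp)
      show "AE s in lborel. indicator I s * m s = (LINT t|lborel. norm (case (s, t) of (s, t) \<Rightarrow> g s t))"
        using AE_inner by eventually_elim (simp add: g0 has_bochner_integral_integral_eq)
    qed measurable
    show "AE s in lborel. integrable lborel (\<lambda>t. case (s, t) of (s, t) \<Rightarrow> g s t)"
      using AE_inner by eventually_elim (auto simp: has_bochner_integral_iff)
  qed measurable
  have "integral\<^sup>L (lborel \<Otimes>\<^sub>M lborel) (\<lambda>(s, t). g s t) = (LINT s|lborel. LINT t|lborel. g s t)"
    using lborel_pair.integral_fst'[OF g_int] by simp
  also have "\<dots> = (LINT s|lborel. indicator I s * m s)"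
  proof (rule integral_cong_AE)
    show "AE s in lborel. (LINT t|lborel. g s t) = indicator I s * m s"
      using AE_inner by eventually_elim (simp add: has_bochner_integral_iff)
    show "(\<lambda>s. indicator I s * m s) \<in> borel_measurable lborel"
      unfolding I_def m_def inner_mahler_def by measurable
  qed measurable
  also have "\<dots> = 4 * pi\<^sup>2 * ln 12 - 2 * pi * (10 * clausen (pi / 3))"
    using m_val by (simp add: set_lebesgue_integral_def)
  finally have g_val: "integral\<^sup>L lborel (\<lambda>(s, t). g s t) = 4 * pi\<^sup>2 * ln 12 - 2 * pi * (10 * clausen (pi / 3))"
    by (simp add: lborel_prod)
  \<comment> \<open>The shift by ln 12 is undone: the box has area 4 pi^2.\<close>
  have c: "has_bochner_integral lborel (\<lambda>x. indicator torus_box x *\<^sub>R ln 12) (4 * pi\<^sup>2 * ln (12::real))"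
  proof -
    have t: "torus_box = cbox (0, 0) (2 * pi, 2 * pi)"
      by (auto simp: torus_box_def cbox_Pair_eq)
    have meas: "measure lborel torus_box = 4 * pi\<^sup>2"
      unfolding t by (simp add: content_Pair power2_eq_square)
    have "emeasure lborel torus_box < \<infinity>" "torus_box \<in> sets lborel"
      unfolding t by (rule emeasure_bounded_finite[OF bounded_cbox]) simp
    then have "has_bochner_integral lborel (\<lambda>x. indicator torus_box x *\<^sub>R ln 12)
        (measure lborel torus_box *\<^sub>R ln (12::real))"
      by (intro has_bochner_integral_scaleR_left has_bochner_integral_real_indicator)
    then show ?thesis unfolding meas by simp
  qed
  have "has_bochner_integral lborel (\<lambda>x. indicator torus_box x *\<^sub>R ln 12 - (case x of (s, t) \<Rightarrow> g s t))
     (4 * pi\<^sup>2 * ln 12 - (4 * pi\<^sup>2 * ln 12 - 2 * pi * (10 * clausen (pi / 3))))"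
    using g_int g_val by (intro has_bochner_integral_diff c) (simp add: has_bochner_integral_iff lborel_prod)
  moreover have "indicator torus_box x *\<^sub>R ln 12 - (case x of (s, t) \<Rightarrow> g s t) =
     indicator torus_box x *\<^sub>R mahler_integrand pL x" for x
    by (auto simp: torus_box_def g_def f_def I_def mahler_integrand_def indicator_def split: prod.splits)
  ultimately have "has_bochner_integral lborel (\<lambda>x. indicator torus_box x *\<^sub>R mahler_integrand pL x)
     (2 * pi * (10 * clausen (pi / 3)))" by simp
  then show "set_integrable lborel torus_box (mahler_integrand pL)"
    "(LINT x : torus_box | lborel. mahler_integrand pL x) = 2 * pi * (10 * clausen (pi / 3))"
    by (auto simp: set_integrable_def set_lebesgue_integral_def has_bochner_integral_iff)
qed

theorem theorem4p2:
  shows "set_integrable lborel torus_box (mahler_integrand pL)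
    \<and> 2 * pi * mahler2 pL = 10 * BlochWigner ((1 + sqrt 3 * \<i>) / 2)
    \<and> 10 * BlochWigner ((1 + sqrt 3 * \<i>) / 2) = 10 * vtet"
proof -
  have z: "(1 + sqrt 3 * \<i>) / 2 = cis (pi / 3)"
    by (simp add: complex_eq_iff cos_60 sin_60)
  \<comment> \<open>On the unit circle ln |z| = 0, so the Bloch-Wigner function reduces to Im
    Li2.\<close>
  have "BlochWigner (cis (pi / 3)) = clausen (pi / 3)"
    by (simp add: BlochWigner_def clausen_eq_Li2)
  moreover have "2 * pi * mahler2 pL = 10 * clausen (pi / 3)"
    unfolding mahler2_def integral_torus_pL(2) by (simp add: power2_eq_square)
  ultimately show ?thesis
    unfolding z vtet_def using integral_torus_pL(1) by simp
qed

end
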